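(* Let $V$ be a finite set and let $f,g:V\to\mathbb{R}$ be two real functions on $V$. Let $n\ge 0$. Then the following identities of linear maps defined on $\mathcal{R}_n(V)$ hold, for all indices for which the left-hand side is defined. (i) For all $0\le i\le j-2$ with $j\le n$: $\tilde\partial_i^f\circ\tilde\partial_j^g=-\,\tilde\partial_{j-1}^g\circ\tilde\partial_i^f$. (ii) For $0\le i,j\le n+1$: $$\tilde\partial_i^f\circ\tilde d_j^g=\begin{cases}-\,\tilde d_{j-1}^g\circ\tilde\partial_i^f, & i\le j-2,\\ \langle f,g\rangle^{V\setminus\{v_{j-1},v_j\}}\,\mathrm{id}, & i=j,\\ -\,\tilde d_j^g\circ\tilde\partial_{i-1}^f, & i\ge j+2,\end{cases}$$ where the case $i=j$ means that for every regular elementary $n$-path $v_0v_1\ldots v_n$ on $V$ one has $\tilde\partial_j^f\circ\tilde d_j^g(v_0\ldots v_n)=\langle f,g\rangle^{V\setminus\{v_{j-1},v_j\}}\,v_0\ldots v_n$ (with $V\setminus\{v_{j-1},v_j\}$ read as $V\setminus\{v_0\}$ if $j=0$ and as $V\setminus\{v_n\}$ if $j=n+1$). (iii) For all $0\le i\le j-1$ with $j\le n+1$: $\tilde d_i^f\circ\tilde d_j^g=-\,\tilde d_{j+1}^g\circ\tilde d_i^f$.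
   Context: For $n\ge 0$, an elementary $n$-path on $V$ is an ordered sequence $v_0v_1\ldots v_n$ of vertices of $V$ (repetitions allowed); it is regular if $v_{i-1}\ne v_i$ for all $1\le i\le n$, and irregular otherwise. $\Lambda_n(V)$ is the real vector space with basis all elementary $n$-paths, $I_n(V)$ is the subspace spanned by the irregular ones, and $\mathcal{R}_n(V)=\Lambda_n(V)/I_n(V)$, identified with the real vector space with basis all regular elementary $n$-paths. For $f:V\to\mathbb{R}$, the weighted face and co-face maps on $\Lambda_n(V)$ are the linear maps $\partial_i^f(v_0\ldots v_n)=(-1)^if(v_i)\,v_0\ldots\widehat{v_i}\ldots v_n$ ($0\le i\le n$; the hat means omission) and $d_i^f(v_0\ldots v_n)=\sum_{v\in V}(-1)^if(v)\,v_0\ldots v_{i-1}\,v\,v_i\ldots v_n$ ($0\le i\le n+1$). The $f$-weighted regular face map $\tilde\partial_i^f:\mathcal{R}_n(V)\to\mathcal{R}_{n-1}(V)$ and regular co-face map $\tilde d_i^f:\mathcal{R}_n(V)\to\mathcal{R}_{n+1}(V)$ are obtained by applying $\partial_i^f$, respectively $d_i^f$, to regular elementary paths and discarding all irregular elementary paths from the result. Explicitly, with $\epsilon(u,v)=1$ if $u\ne v$ and $0$ if $u=v$, for a regular elementary $n$-path $v_0\ldots v_n$: $$\tilde\partial_i^f(v_0\ldots v_n)=(-1)^i\,\epsilon(v_{i-1},v_{i+1})\,f(v_i)\,v_0\ldots\widehat{v_i}\ldots v_n\qquad(0\le i\le n),$$ with the convention that the factor $\epsilon(v_{i-1},v_{i+1})$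 is $1$ when $i=0$ or $i=n$; and $$\tilde d_i^f(v_0\ldots v_n)=\sum_{v\in V,\ v\ne v_{i-1},\,v\neq v_i}(-1)^if(v)\,v_0\ldots v_{i-1}\,v\,v_i\ldots v_n\qquad(0\le i\le n+1),$$ with the convention that for $i=0$ the only condition is $v\ne v_0$ and for $i=n+1$ the only condition is $v\ne v_n$. For a subset $W\subseteq V$, $\langle f,g\rangle^{W}=\sum_{v\in W}f(v)g(v)$. *)

theory Defs
  imports "HOL-Analysis.Finite_Function_Topology"
begin

text \<open>
  The path \<open>v\<^sub>0 v\<^sub>1 \<dots> v\<^sub>n\<close> is the list \<open>[v\<^sub>0, v\<^sub>1, \<dots>, v\<^sub>n]\<close>, so an \<open>n\<close>-path has length \<open>n + 1\<close>.
  All path spaces live in the free real vector space \<open>'v list \<Rightarrow>\<^sub>0 real\<close> on the set of lists, whose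
  real vector space structure comes from \<^theory>\<open>HOL-Analysis.Finite_Function_Topology\<close>.
\<close>

type_synonym 'v chain = "'v list \<Rightarrow>\<^sub>0 real"

definition elementary_paths :: "'v set \<Rightarrow> nat \<Rightarrow> 'v list set" where
  "elementary_paths V n = {p. length p = Suc n \<and> set p \<subseteq> V}"

definition regular_paths :: "'v set \<Rightarrow> nat \<Rightarrow> 'v list set" where
  "regular_paths V n = {p \<in> elementary_paths V n. distinct_adj p}"

definition path_vec :: "'v list \<Rightarrow> 'v chain" where
  "path_vec p = Poly_Mapping.single p 1"

definition path_space :: "'v set \<Rightarrow> nat \<Rightarrow> 'v chain set"  (\<open>\<Lambda>\<close>) where
  "\<Lambda> V n = span (path_vec ` elementary_paths V n)"

definition irregular_space :: "'v set \<Rightarrow> nat \<Rightarrow> 'v chain set" where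
  "irregular_space V n = span (path_vec ` (elementary_paths V n - regular_paths V n))"

text \<open>
  \<open>\<R> V n\<close> is the quotient \<open>\<Lambda> V n / irregular_space V n\<close> in its identification with the space
  spanned by the regular elementary paths; see \<open>discard_irregular_range\<close> and
  \<open>discard_irregular_kernel\<close> below.
\<close>

definition regular_space :: "'v set \<Rightarrow> nat \<Rightarrow> 'v chain set"  (\<open>\<R>\<close>) where
  "\<R> V n = span (path_vec ` regular_paths V n)"

definition linear_ext :: "('v list \<Rightarrow> 'v chain) \<Rightarrow> 'v chain \<Rightarrow> 'v chain" where
  "linear_ext h x = (\<Sum>p\<in>Poly_Mapping.keys x. Poly_Mapping.lookup x p *\<^sub>R h p)"

definition face :: "('v \<Rightarrow> real) \<Rightarrow> nat \<Rightarrow> 'v chain \<Rightarrow> 'v chain" where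
  "face f i = linear_ext (\<lambda>p. ((-1) ^ i * f (p ! i)) *\<^sub>R path_vec (take i p @ drop (Suc i) p))"

definition coface :: "'v set \<Rightarrow> ('v \<Rightarrow> real) \<Rightarrow> nat \<Rightarrow> 'v chain \<Rightarrow> 'v chain" where
  "coface V f i =
    linear_ext (\<lambda>p. \<Sum>v\<in>V. ((-1) ^ i * f v) *\<^sub>R path_vec (take i p @ v # drop i p))"

definition discard_irregular :: "'v chain \<Rightarrow> 'v chain" where
  "discard_irregular = linear_ext (\<lambda>p. if distinct_adj p then path_vec p else 0)"

text \<open>
  The two maps below are total functions on chains. They stand for maps out of \<open>\<R> V n\<close> only for
  \<open>i \<le> n\<close>, respectively \<open>i \<le> n + 1\<close>.
\<close>

definition regular_face :: "('v \<Rightarrow> real) \<Rightarrow> nat \<Rightarrow> 'v chain \<Rightarrow> 'v chain" where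
  "regular_face f i = discard_irregular \<circ> face f i"

definition regular_coface :: "'v set \<Rightarrow> ('v \<Rightarrow> real) \<Rightarrow> nat \<Rightarrow> 'v chain \<Rightarrow> 'v chain" where
  "regular_coface V f i = discard_irregular \<circ> coface V f i"

definition inner_on :: "'v set \<Rightarrow> ('v \<Rightarrow> real) \<Rightarrow> ('v \<Rightarrow> real) \<Rightarrow> real" where
  "inner_on W f g = (\<Sum>v\<in>W. f v * g v)"


lemma lookup_scaleR_chain:
  "Poly_Mapping.lookup (r *\<^sub>R (x :: 'v chain)) p = r * Poly_Mapping.lookup x p"
proof -
  have "finite {i. r *\<^sub>R Poly_Mapping.lookup x i \<noteq> 0}"
    by (rule finite_subset[OF _ finite_keys[of x]]) (auto simp: in_keys_iff)
  then show ?thesis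
    by (simp add: scaleR_poly_mapping_def)
qed

lemma linear_ext_superset:
  assumes "finite S" "Poly_Mapping.keys x \<subseteq> S"
  shows "linear_ext h x = (\<Sum>p\<in>S. Poly_Mapping.lookup x p *\<^sub>R h p)"
  unfolding linear_ext_def
  by (rule sum.mono_neutral_left) (use assms in \<open>auto simp: in_keys_iff\<close>)

lemma linear_linear_ext: "linear (linear_ext h)"
proof (rule linearI)
  fix x y :: "'a chain" and r :: real
  let ?S = "Poly_Mapping.keys x \<union> Poly_Mapping.keys y"
  have "Poly_Mapping.keys (x + y) \<subseteq> ?S"
    by (rule Poly_Mapping.keys_add)
  then show "linear_ext h (x + y) = linear_ext h x + linear_ext h y"
    by (simp add: linear_ext_superset[of ?S] lookup_add scaleR_add_left sum.distrib)
  have "Poly_Mapping.keys (r *\<^sub>R x) \<subseteq> Poly_Mapping.keys x"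
    by (auto simp: in_keys_iff lookup_scaleR_chain)
  then show "linear_ext h (r *\<^sub>R x) = r *\<^sub>R linear_ext h x"
    by (simp add: linear_ext_superset[of "Poly_Mapping.keys x"] lookup_scaleR_chain
        scaleR_sum_right)
qed

lemma linear_ext_path_vec: "linear_ext h (path_vec p) = h p"
  by (simp add: linear_ext_def path_vec_def)

lemma linear_discard_irregular: "linear discard_irregular"
  by (simp add: discard_irregular_def linear_linear_ext)

lemma discard_irregular_path_vec:
  "discard_irregular (path_vec p) = (if distinct_adj p then path_vec p else 0)"
  by (simp add: discard_irregular_def linear_ext_path_vec)

lemma linear_regular_face: "linear (regular_face f i)"
  by (simp add: regular_face_def face_def linear_compose linear_linear_ext
      linear_discard_irregular)

lemma linear_regular_coface: "linear (regular_coface V f i)"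
  by (simp add: regular_coface_def coface_def linear_compose linear_linear_ext
      linear_discard_irregular)

lemma discard_irregular_range: "discard_irregular ` \<Lambda> V n = \<R> V n"
proof -
  have "discard_irregular ` \<Lambda> V n
      = span (discard_irregular ` path_vec ` elementary_paths V n)"
    by (simp add: path_space_def linear_span_image linear_discard_irregular)
  also have "\<dots> = span (path_vec ` regular_paths V n)"
  proof (rule span_eq[THEN iffD2], intro conjI subsetI)
    fix x assume "x \<in> discard_irregular ` path_vec ` elementary_paths V n"
    then show "x \<in> span (path_vec ` regular_paths V n)"
      by (auto simp: discard_irregular_path_vec regular_paths_def span_zero
          intro!: span_base[OF imageI])
  next
    fix x assume "x \<in> path_vec ` regular_paths V n"
    then show "x \<in> span (discard_irregular ` path_vec ` elementary_paths V n)"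
      by (intro span_base) (force simp: discard_irregular_path_vec regular_paths_def)
  qed
  finally show ?thesis
    by (simp add: regular_space_def)
qed

lemma discard_irregular_kernel:
  "{x \<in> \<Lambda> V n. discard_irregular x = 0} = irregular_space V n"
proof (intro subset_antisym subsetI)
  fix x assume x: "x \<in> {x \<in> \<Lambda> V n. discard_irregular x = 0}"
  have "linear (\<lambda>x. x - discard_irregular x)"
    by (intro linear_compose_sub linear_ident linear_discard_irregular)
  then have "(\<lambda>x. x - discard_irregular x) ` \<Lambda> V n
      = span ((\<lambda>x. x - discard_irregular x) ` path_vec ` elementary_paths V n)"
    unfolding path_space_def by (rule linear_span_image[symmetric])
  also have "\<dots> \<subseteq> irregular_space V n"
    unfolding irregular_space_def
    by (rule span_minimal)
      (auto simp: discard_irregular_path_vec regular_paths_def span_zero subspace_span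
          intro!: span_base[OF imageI])
  finally show "x \<in> irregular_space V n"
    using x by force
next
  fix x assume x: "x \<in> irregular_space V n"
  have "irregular_space V n \<subseteq> \<Lambda> V n"
    unfolding irregular_space_def path_space_def by (intro span_mono) auto
  moreover have "discard_irregular x = 0"
    using x unfolding irregular_space_def
    by (rule linear_eq_0_on_span[OF linear_discard_irregular, rotated])
      (auto simp: discard_irregular_path_vec regular_paths_def split: if_splits)
  ultimately show "x \<in> {x \<in> \<Lambda> V n. discard_irregular x = 0}"
    using x by auto
qed

lemma distinct_adj_remove_nth:
  assumes "distinct_adj p" "length p = Suc n" "i \<le> n"
  shows "distinct_adj (take i p @ drop (Suc i) p)
    \<longleftrightarrow> (i = 0 \<or> i = n \<or> p ! (i - 1) \<noteq> p ! Suc i)"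
proof -
  have "distinct_adj (take i p)" "distinct_adj (drop (Suc i) p)"
    using assms(1) append_take_drop_id distinct_adj_appendD1 distinct_adj_appendD2 by metis+
  moreover have "last (take i p) = p ! (i - 1)" if "i \<noteq> 0"
    using that assms by (subst last_conv_nth) (auto simp: min_def)
  moreover have "hd (drop (Suc i) p) = p ! Suc i" if "i \<noteq> n"
    using that assms by (simp add: hd_drop_conv_nth)
  ultimately show ?thesis
    using assms by (auto simp: distinct_adj_append_iff)
qed

lemma distinct_adj_insert_nth:
  assumes "distinct_adj p" "length p = Suc n" "i \<le> Suc n"
  shows "distinct_adj (take i p @ v # drop i p)
    \<longleftrightarrow> (i = 0 \<or> v \<noteq> p ! (i - 1)) \<and> (i = Suc n \<or> v \<noteq> p ! i)"
proof -
  have "distinct_adj (take i p)" "distinct_adj (drop i p)"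
    using assms(1) append_take_drop_id distinct_adj_appendD1 distinct_adj_appendD2 by metis+
  moreover have "last (take i p) = p ! (i - 1)" if "i \<noteq> 0"
    using that assms by (subst last_conv_nth) (auto simp: min_def)
  moreover have "hd (drop i p) = p ! i" if "i \<noteq> Suc n"
    using that assms by (simp add: hd_drop_conv_nth)
  ultimately show ?thesis
    using assms by (auto simp: distinct_adj_append_iff distinct_adj_Cons)
qed

lemma regular_face_path_vec:
  assumes "p \<in> regular_paths V n" "i \<le> n"
  shows "regular_face f i (path_vec p) =
    (if i = 0 \<or> i = n \<or> p ! (i - 1) \<noteq> p ! Suc i
     then ((-1) ^ i * f (p ! i)) *\<^sub>R path_vec (take i p @ drop (Suc i) p) else 0)"
proof -
  have "distinct_adj p" "length p = Suc n"
    using assms by (auto simp: regular_paths_def elementary_paths_def)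
  then show ?thesis
    using assms
    by (simp add: regular_face_def face_def linear_ext_path_vec discard_irregular_path_vec
        linear_scale[OF linear_discard_irregular] distinct_adj_remove_nth)
qed

lemma regular_coface_path_vec:
  assumes "finite V" "p \<in> regular_paths V n" "i \<le> Suc n"
  shows "regular_coface V f i (path_vec p) =
    (\<Sum>v | v \<in> V \<and> (i = 0 \<or> v \<noteq> p ! (i - 1)) \<and> (i = Suc n \<or> v \<noteq> p ! i).
      ((-1) ^ i * f v) *\<^sub>R path_vec (take i p @ v # drop i p))"
proof -
  have p: "distinct_adj p" "length p = Suc n"
    using assms by (auto simp: regular_paths_def elementary_paths_def)
  have "regular_coface V f i (path_vec p) =
    (\<Sum>v\<in>V. if (i = 0 \<or> v \<noteq> p ! (i - 1)) \<and> (i = Suc n \<or> v \<noteq> p ! i)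
      then ((-1) ^ i * f v) *\<^sub>R path_vec (take i p @ v # drop i p) else 0)"
    using p assms
    by (auto simp: regular_coface_def coface_def linear_ext_path_vec discard_irregular_path_vec
        linear_sum[OF linear_discard_irregular] linear_scale[OF linear_discard_irregular]
        distinct_adj_insert_nth intro!: sum.cong)
  also have "\<dots> = (\<Sum>v | v \<in> V \<and> (i = 0 \<or> v \<noteq> p ! (i - 1)) \<and> (i = Suc n \<or> v \<noteq> p ! i).
      ((-1) ^ i * f v) *\<^sub>R path_vec (take i p @ v # drop i p))"
    using assms(1) by (rule sum.inter_filter[symmetric])
  finally show ?thesis .
qed

lemma regular_face_image:
  assumes "i \<le> Suc n"
  shows "regular_face f i ` \<R> V (Suc n) \<subseteq> \<R> V n"
proof -
  have "regular_face f i ` \<R> V (Suc n)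
      = span (regular_face f i ` path_vec ` regular_paths V (Suc n))"
    unfolding regular_space_def by (rule linear_span_image[OF linear_regular_face, symmetric])
  also have "\<dots> \<subseteq> \<R> V n"
  proof (rule span_minimal)
    show "regular_face f i ` path_vec ` regular_paths V (Suc n) \<subseteq> \<R> V n"
    proof clarify
      fix p assume p: "p \<in> regular_paths V (Suc n)"
      have "take i p @ drop (Suc i) p \<in> elementary_paths V n"
        using p assms
        by (auto simp: regular_paths_def elementary_paths_def dest: in_set_takeD in_set_dropD)
      then have "face f i (path_vec p) \<in> \<Lambda> V n"
        by (auto simp: face_def linear_ext_path_vec path_space_def
            intro!: span_scale span_base[OF imageI])
      then show "regular_face f i (path_vec p) \<in> \<R> V n"
        by (auto simp: regular_face_def simp flip: discard_irregular_range)
    qed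
  qed (simp add: regular_space_def)
  finally show ?thesis .
qed

lemma regular_coface_image:
  assumes "i \<le> Suc n"
  shows "regular_coface V f i ` \<R> V n \<subseteq> \<R> V (Suc n)"
proof -
  have "regular_coface V f i ` \<R> V n
      = span (regular_coface V f i ` path_vec ` regular_paths V n)"
    unfolding regular_space_def by (rule linear_span_image[OF linear_regular_coface, symmetric])
  also have "\<dots> \<subseteq> \<R> V (Suc n)"
  proof (rule span_minimal)
    show "regular_coface V f i ` path_vec ` regular_paths V n \<subseteq> \<R> V (Suc n)"
    proof clarify
      fix p assume p: "p \<in> regular_paths V n"
      have "take i p @ v # drop i p \<in> elementary_paths V (Suc n)" if "v \<in> V" for v
        using p assms that
        by (auto simp: regular_paths_def elementary_paths_def dest: in_set_takeD in_set_dropD)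
      then have "coface V f i (path_vec p) \<in> \<Lambda> V (Suc n)"
        by (auto simp: coface_def linear_ext_path_vec path_space_def
            intro!: span_sum span_scale span_base[OF imageI])
      then show "regular_coface V f i (path_vec p) \<in> \<R> V (Suc n)"
        by (auto simp: regular_coface_def simp flip: discard_irregular_range)
    qed
  qed (simp add: regular_space_def)
  finally show ?thesis .
qed

end

theory Submission
  imports Defs
begin

text \<open>
  Cut a regular path as \<open>a @ b @ c\<close> with \<open>b\<close> nonempty. Since
  \<open>b\<close> separates \<open>a\<close> from \<open>c\<close>, regularity of the whole path
  means regularity of \<open>a @ b\<close> together with regularity of \<open>b @ c\<close>
  (\<open>distinct_adj_append_overlap\<close>). Hence an edit inside \<open>a\<close> (deleting
  its last vertex, or appending one) and an edit inside \<open>c\<close> (deleting its first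
  vertex, or prepending one) do not influence each other: for a regular path and the edits
  performed in either order, the intermediate and final paths are regular under the same condition
  (\<open>regular_edits_commute\<close>). The index conditions in the commutation identities say
  exactly that the two edited positions are separated by such a nonempty \<open>b\<close>. It
  remains to compare the signs; the edit on the left shifts the position of the one on the right
  by one, which produces the minus sign. All maps are linear, so a comparison on regular
  elementary paths suffices.

  If the same position is filled and emptied again, the original path comes back with weight
  \<open>f v * g v\<close> for each admissible vertex \<open>v\<close>, that is, for each
  \<open>v\<close> different from its neighbours.
\<close>

section \<open>Regularity and separated edits\<close>

lemma distinct_adj_append_overlap:
  assumes "b \<noteq> []"
  shows "distinct_adj (a @ b @ c) \<longleftrightarrow> distinct_adj (a @ b) \<and> distinct_adj (b @ c)"
  using assms by (auto simp: distinct_adj_append_iff)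

text \<open>
  The class in \<open>\<R>\<close> of an elementary path, regular or not. It vanishes on irregular paths, so that
  below the co-face map can be written as a sum over all of \<open>V\<close>.
\<close>

definition path_class :: "'v list \<Rightarrow> 'v chain" where
  "path_class p = discard_irregular (path_vec p)"

lemma path_class_regular: "distinct_adj p \<Longrightarrow> path_class p = path_vec p"
  by (simp add: path_class_def discard_irregular_path_vec)

lemma path_class_irregular: "\<not> distinct_adj p \<Longrightarrow> path_class p = 0"
  by (simp add: path_class_def discard_irregular_path_vec)

text \<open>
  Here \<open>a\<close> is edited to \<open>a'\<close> and \<open>c\<close> to \<open>c'\<close>. The condition on each side is the regularity of the
  intermediate path, after only one of the edits has been made.
\<close>

lemma regular_edits_commute:
  assumes "distinct_adj (a @ b @ c)" "b \<noteq> []"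
  shows "(if distinct_adj (a @ b @ c') then path_class (a' @ b @ c') else 0)
       = (if distinct_adj (a' @ b @ c) then path_class (a' @ b @ c') else 0)"
  using assms by (auto simp: distinct_adj_append_overlap path_class_irregular)

section \<open>Face and co-face maps on paths\<close>

lemma regular_face_append:
  "regular_face f (length a) (path_vec (a @ x # c))
    = ((-1) ^ length a * f x) *\<^sub>R path_class (a @ c)"
  by (simp add: regular_face_def face_def linear_ext_path_vec path_class_def
      linear_scale[OF linear_discard_irregular])

lemma regular_coface_append:
  "regular_coface V f (length a) (path_vec (a @ c))
    = (\<Sum>v\<in>V. ((-1) ^ length a * f v) *\<^sub>R path_class (a @ v # c))"
  by (simp add: regular_coface_def coface_def linear_ext_path_vec path_class_def
      linear_sum[OF linear_discard_irregular] linear_scale[OF linear_discard_irregular])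

text \<open>
  A second map applied after a first one meets a class that may be zero; this is the condition in the
  following two lemmas.
\<close>

lemma regular_face_path_class:
  "regular_face f (length a) (path_class (a @ x # c))
    = ((-1) ^ length a * f x) *\<^sub>R (if distinct_adj (a @ x # c) then path_class (a @ c) else 0)"
  by (simp add: path_class_regular path_class_irregular regular_face_append
      linear_0[OF linear_regular_face])

lemma regular_coface_path_class:
  "regular_coface V f (length a) (path_class (a @ c))
    = (\<Sum>v\<in>V. ((-1) ^ length a * f v) *\<^sub>R
        (if distinct_adj (a @ c) then path_class (a @ v # c) else 0))"
  by (cases "distinct_adj (a @ c)")
    (simp_all add: path_class_regular path_class_irregular regular_coface_append
      linear_0[OF linear_regular_coface])

section \<open>Commutation of separated face and co-face maps\<close>

lemma face_face_path_vec:
  assumes "distinct_adj (a @ x # b @ y # c)" "b \<noteq> []"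
    and i: "i = length a" and j: "j = Suc (length a + length b)"
  shows "regular_face f i (regular_face g j (path_vec (a @ x # b @ y # c)))
    = - regular_face g (j - 1) (regular_face f i (path_vec (a @ x # b @ y # c)))"
proof -
  have "regular_face f i (regular_face g j (path_vec (a @ x # b @ y # c)))
      = ((-1) ^ j * g y * ((-1) ^ i * f x)) *\<^sub>R
          (if distinct_adj (a @ x # b @ c) then path_class (a @ b @ c) else 0)"
    using regular_face_append[of g "a @ x # b" y c] regular_face_path_class[of f a x "b @ c"] i j
    by (simp add: linear_scale[OF linear_regular_face] linear_neg[OF linear_regular_face]
        cong: if_cong)
  also have "\<dots> = - (((-1) ^ i * f x * ((-1) ^ (j - 1) * g y)) *\<^sub>R
          (if distinct_adj (a @ b @ y # c) then path_class (a @ b @ c) else 0))"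
    using regular_edits_commute[of "a @ [x]" b "y # c" c a] assms
    by (simp add: ac_simps cong: if_cong)
  also have "\<dots> = - regular_face g (j - 1) (regular_face f i (path_vec (a @ x # b @ y # c)))"
    using regular_face_append[of f a x "b @ y # c"] regular_face_path_class[of g "a @ b" y c] i j
    by (simp add: linear_scale[OF linear_regular_face] linear_neg[OF linear_regular_face]
        cong: if_cong)
  finally show ?thesis .
qed

lemma face_coface_path_vec:
  assumes "distinct_adj (a @ x # b @ c)" "b \<noteq> []"
    and i: "i = length a" and j: "j = Suc (length a + length b)"
  shows "regular_face f i (regular_coface V g j (path_vec (a @ x # b @ c)))
    = - regular_coface V g (j - 1) (regular_face f i (path_vec (a @ x # b @ c)))"
proof -
  have "regular_face f i (regular_coface V g j (path_vec (a @ x # b @ c)))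
      = (\<Sum>v\<in>V. ((-1) ^ j * g v * ((-1) ^ i * f x)) *\<^sub>R
          (if distinct_adj (a @ x # b @ v # c) then path_class (a @ b @ v # c) else 0))"
    using regular_coface_append[of V g "a @ x # b" c]
      regular_face_path_class[of f a x "b @ _ # c"] i j
    by (simp add: linear_scale[OF linear_regular_face] linear_neg[OF linear_regular_face]
        linear_sum[OF linear_regular_face] cong: if_cong)
  also have "\<dots> = (\<Sum>v\<in>V. - (((-1) ^ i * f x * ((-1) ^ (j - 1) * g v)) *\<^sub>R
          (if distinct_adj (a @ b @ c) then path_class (a @ b @ v # c) else 0)))"
    using regular_edits_commute[of "a @ [x]" b c "_ # c" a] assms
    by (intro sum.cong) (simp_all add: ac_simps cong: if_cong)
  also have "\<dots> = - regular_coface V g (j - 1) (regular_face f i (path_vec (a @ x # b @ c)))"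
    using regular_face_append[of f a x "b @ c"] regular_coface_path_class[of V g "a @ b" c] i j
    by (simp add: linear_scale[OF linear_regular_coface] linear_neg[OF linear_regular_coface]
        scaleR_sum_right sum_negf cong: if_cong)
  finally show ?thesis .
qed

text \<open>
  The two sides index the vertex \<open>y\<close> differently: it sits at position \<open>i\<close> once the co-face map has
  inserted a vertex before it, and at position \<open>i - 1\<close> in the original path.
\<close>

lemma coface_face_path_vec:
  assumes "distinct_adj (a @ b @ y # c)" "b \<noteq> []"
    and j: "j = length a" and i: "i = Suc (length a + length b)"
  shows "regular_face f i (regular_coface V g j (path_vec (a @ b @ y # c)))
    = - regular_coface V g j (regular_face f (i - 1) (path_vec (a @ b @ y # c)))"
proof -
  have "regular_face f i (regular_coface V g j (path_vec (a @ b @ y # c)))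
      = (\<Sum>v\<in>V. ((-1) ^ j * g v * ((-1) ^ i * f y)) *\<^sub>R
          (if distinct_adj (a @ v # b @ y # c) then path_class (a @ v # b @ c) else 0))"
    using regular_coface_append[of V g a "b @ y # c"]
      regular_face_path_class[of f "a @ _ # b" y c] i j
    by (simp add: linear_scale[OF linear_regular_face] linear_neg[OF linear_regular_face]
        linear_sum[OF linear_regular_face] cong: if_cong)
  also have "\<dots> = (\<Sum>v\<in>V. - (((-1) ^ (i - 1) * f y * ((-1) ^ j * g v)) *\<^sub>R
          (if distinct_adj (a @ b @ c) then path_class (a @ v # b @ c) else 0)))"
    using regular_edits_commute[of a b "y # c" c "a @ [_]"] assms
    by (intro sum.cong) (simp_all add: ac_simps cong: if_cong)
  also have "\<dots> = - regular_coface V g j (regular_face f (i - 1) (path_vec (a @ b @ y # c)))"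
    using regular_face_append[of f "a @ b" y c] regular_coface_path_class[of V g a "b @ c"] i j
    by (simp add: linear_scale[OF linear_regular_coface] linear_neg[OF linear_regular_coface]
        scaleR_sum_right sum_negf cong: if_cong)
  finally show ?thesis .
qed

lemma coface_coface_path_vec:
  assumes "distinct_adj (a @ b @ c)" "b \<noteq> []"
    and i: "i = length a" and j: "j = length a + length b"
  shows "regular_coface V f i (regular_coface V g j (path_vec (a @ b @ c)))
    = - regular_coface V g (j + 1) (regular_coface V f i (path_vec (a @ b @ c)))"
proof -
  have "regular_coface V f i (regular_coface V g j (path_vec (a @ b @ c)))
      = (\<Sum>v\<in>V. \<Sum>u\<in>V. ((-1) ^ j * g v * ((-1) ^ i * f u)) *\<^sub>R
          (if distinct_adj (a @ b @ v # c) then path_class (a @ u # b @ v # c) else 0))"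
    using regular_coface_append[of V g "a @ b" c]
      regular_coface_path_class[of V f a "b @ _ # c"] i j
    by (simp add: linear_scale[OF linear_regular_coface] linear_neg[OF linear_regular_coface]
        linear_sum[OF linear_regular_coface] scaleR_sum_right cong: if_cong)
  also have "\<dots> = (\<Sum>u\<in>V. \<Sum>v\<in>V. ((-1) ^ j * g v * ((-1) ^ i * f u)) *\<^sub>R
          (if distinct_adj (a @ b @ v # c) then path_class (a @ u # b @ v # c) else 0))"
    by (rule sum.swap)
  also have "\<dots> = (\<Sum>u\<in>V. \<Sum>v\<in>V. - (((-1) ^ i * f u * ((-1) ^ (j + 1) * g v)) *\<^sub>R
          (if distinct_adj (a @ u # b @ c) then path_class (a @ u # b @ v # c) else 0)))"
    using regular_edits_commute[of a b c "_ # c" "a @ [_]"] assms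
    by (intro sum.cong) (simp_all add: ac_simps cong: if_cong)
  also have "\<dots> = - regular_coface V g (j + 1) (regular_coface V f i (path_vec (a @ b @ c)))"
    using regular_coface_append[of V f a "b @ c"]
      regular_coface_path_class[of V g "a @ _ # b" c] i j
    by (simp add: linear_scale[OF linear_regular_coface] linear_neg[OF linear_regular_coface]
        linear_sum[OF linear_regular_coface] scaleR_sum_right sum_negf cong: if_cong)
  finally show ?thesis .
qed

section \<open>Inserting and deleting at the same position\<close>

lemma face_coface_same_path_vec:
  assumes V: "finite V" and p: "distinct_adj p" "length p = Suc n" and j: "j \<le> Suc n"
  shows "regular_face f j (regular_coface V g j (path_vec p))
    = inner_on (V - (if j = 0 then {p ! 0} else if j = n + 1 then {p ! n}
                     else {p ! (j - 1), p ! j})) f g *\<^sub>R path_vec p"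
    (is "_ = inner_on ?W f g *\<^sub>R _")
proof -
  define a c where "a = take j p" and "c = drop j p"
  have pac: "p = a @ c" and ja: "j = length a"
    using p j by (simp_all add: a_def c_def)
  have W: "?W = {v \<in> V. distinct_adj (a @ v # c)}"
    using distinct_adj_insert_nth[OF p j] p j by (auto simp: a_def c_def)
  have "regular_face f j (regular_coface V g j (path_vec p))
      = (\<Sum>v\<in>V. ((-1) ^ j * g v * ((-1) ^ j * f v)) *\<^sub>R
          (if distinct_adj (a @ v # c) then path_class p else 0))"
    using regular_coface_append[of V g a c] regular_face_path_class[of f a _ c]
    by (simp add: pac ja linear_scale[OF linear_regular_face] linear_neg[OF linear_regular_face]
        linear_sum[OF linear_regular_face] cong: if_cong)
  also have "\<dots> = (\<Sum>v\<in>V. if distinct_adj (a @ v # c) then (f v * g v) *\<^sub>R path_vec p else 0)"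
    by (intro sum.cong)
      (simp_all add: path_class_regular[OF p(1)] mult.assoc mult.left_commute[of "g _"]
        mult.commute[of "g _"] flip: power_mult_distrib)
  also have "\<dots> = (\<Sum>v\<in>?W. (f v * g v) *\<^sub>R path_vec p)"
    unfolding W using V by (rule sum.inter_filter[symmetric])
  also have "\<dots> = inner_on ?W f g *\<^sub>R path_vec p"
    by (simp add: inner_on_def scaleR_sum_left)
  finally show ?thesis .
qed

section \<open>The identities on the space of regular paths\<close>

lemma compose_eq_neg_compose_on_regular_space:
  assumes "linear A" "linear B" "linear C" "linear D"
    and eq: "\<And>p. distinct_adj p \<Longrightarrow> length p = Suc n \<Longrightarrow>
      A (B (path_vec p)) = - C (D (path_vec p))"
    and x: "x \<in> \<R> V n"
  shows "A (B x) = - C (D x)"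
proof -
  have AB: "linear (\<lambda>x. A (B x))"
    using linear_compose[OF assms(2,1)] by (simp add: o_def)
  have CD: "linear (\<lambda>x. - C (D x))"
    using linear_compose_neg[OF linear_compose[OF assms(4,3)]] by (simp add: o_def)
  show ?thesis
  proof (rule linear_eq_on[OF AB CD])
    show "x \<in> span (path_vec ` regular_paths V n)"
      using x by (simp add: regular_space_def)
  qed (auto simp: regular_paths_def elementary_paths_def intro: eq)
qed

lemma split_at_index:
  assumes "i < length p"
  obtains a x c where "p = a @ x # c" "length a = i"
  using assms id_take_nth_drop[OF assms] by (metis length_take min.absorb4)

lemma split_before_index:
  assumes "i \<le> length p"
  obtains a c where "p = a @ c" "length a = i"
  using assms by (metis append_take_drop_id length_take min.absorb2)

lemma regular_face_regular_face:
  assumes "i + 2 \<le> j" "j \<le> n" "x \<in> \<R> V n"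
  shows "regular_face f i (regular_face g j x) = - regular_face g (j - 1) (regular_face f i x)"
proof (rule compose_eq_neg_compose_on_regular_space[OF linear_regular_face linear_regular_face
      linear_regular_face linear_regular_face _ assms(3)])
  fix p :: "'a list" assume p: "distinct_adj p" "length p = Suc n"
  obtain r y c where 1: "p = r @ y # c" "length r = j"
    using assms p by (elim split_at_index[of j p, rotated]) auto
  obtain a x b where 2: "r = a @ x # b" "length a = i"
    using assms 1 by (elim split_at_index[of i r, rotated]) auto
  show "regular_face f i (regular_face g j (path_vec p))
      = - regular_face g (j - 1) (regular_face f i (path_vec p))"
    using face_face_path_vec[of a x b y c i j f g] p assms 1 2
    \<comment> \<open>The index condition rules out an empty \<open>b\<close>.\<close>
    by (cases "b = []") auto
qed

lemma regular_face_regular_coface_left: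
  assumes "i + 2 \<le> j" "j \<le> n + 1" "x \<in> \<R> V n"
  shows "regular_face f i (regular_coface V g j x)
    = - regular_coface V g (j - 1) (regular_face f i x)"
proof (rule compose_eq_neg_compose_on_regular_space[OF linear_regular_face linear_regular_coface
      linear_regular_coface linear_regular_face _ assms(3)])
  fix p :: "'a list" assume p: "distinct_adj p" "length p = Suc n"
  obtain r c where 1: "p = r @ c" "length r = j"
    using assms p by (elim split_before_index[of j p, rotated]) auto
  obtain a x b where 2: "r = a @ x # b" "length a = i"
    using assms 1 by (elim split_at_index[of i r, rotated]) auto
  show "regular_face f i (regular_coface V g j (path_vec p))
      = - regular_coface V g (j - 1) (regular_face f i (path_vec p))"
    using face_coface_path_vec[of a x b c i j f V g] p assms 1 2
    \<comment> \<open>The index condition rules out an empty \<open>b\<close>.\<close>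
    by (cases "b = []") auto
qed

lemma regular_face_regular_coface_right:
  assumes "j + 2 \<le> i" "i \<le> n + 1" "x \<in> \<R> V n"
  shows "regular_face f i (regular_coface V g j x)
    = - regular_coface V g j (regular_face f (i - 1) x)"
proof (rule compose_eq_neg_compose_on_regular_space[OF linear_regular_face linear_regular_coface
      linear_regular_coface linear_regular_face _ assms(3)])
  fix p :: "'a list" assume p: "distinct_adj p" "length p = Suc n"
  obtain r y c where 1: "p = r @ y # c" "length r = i - 1"
    using assms p by (elim split_at_index[of "i - 1" p, rotated]) auto
  obtain a b where 2: "r = a @ b" "length a = j"
    using assms 1 by (elim split_before_index[of j r, rotated]) auto
  show "regular_face f i (regular_coface V g j (path_vec p))
      = - regular_coface V g j (regular_face f (i - 1) (path_vec p))"
    using coface_face_path_vec[of a b y c j i f V g] p assms 1 2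
    \<comment> \<open>The index condition rules out an empty \<open>b\<close>.\<close>
    by (cases "b = []") auto
qed

lemma regular_coface_regular_coface:
  assumes "i + 1 \<le> j" "j \<le> n + 1" "x \<in> \<R> V n"
  shows "regular_coface V f i (regular_coface V g j x)
    = - regular_coface V g (j + 1) (regular_coface V f i x)"
proof (rule compose_eq_neg_compose_on_regular_space[OF linear_regular_coface linear_regular_coface
      linear_regular_coface linear_regular_coface _ assms(3)])
  fix p :: "'a list" assume p: "distinct_adj p" "length p = Suc n"
  obtain r c where 1: "p = r @ c" "length r = j"
    using assms p by (elim split_before_index[of j p, rotated]) auto
  obtain a b where 2: "r = a @ b" "length a = i"
    using assms 1 by (elim split_before_index[of i r, rotated]) auto
  show "regular_coface V f i (regular_coface V g j (path_vec p))
      = - regular_coface V g (j + 1) (regular_coface V f i (path_vec p))"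
    using coface_coface_path_vec[of a b c i j V f g] p assms 1 2
    \<comment> \<open>The index condition rules out an empty \<open>b\<close>.\<close>
    by (cases "b = []") auto
qed

theorem theorem3p1:
  fixes V :: "'v set" and f g :: "'v \<Rightarrow> real" and n :: nat
  assumes "finite V"
  shows
    "(\<forall>i j. i + 2 \<le> j \<and> j \<le> n \<longrightarrow>
        (\<forall>x \<in> \<R> V n.
          (regular_face f i \<circ> regular_face g j) x
            = - (regular_face g (j - 1) \<circ> regular_face f i) x))
   \<and> (\<forall>i j. i \<le> n + 1 \<and> j \<le> n + 1 \<longrightarrow>
        (i + 2 \<le> j \<longrightarrow>
          (\<forall>x \<in> \<R> V n.
            (regular_face f i \<circ> regular_coface V g j) x
              = - (regular_coface V g (j - 1) \<circ> regular_face f i) x))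
      \<and> (i = j \<longrightarrow>
          (\<forall>p \<in> regular_paths V n.
            (regular_face f j \<circ> regular_coface V g j) (path_vec p)
              = inner_on (V - (if j = 0 then {p ! 0}
                               else if j = n + 1 then {p ! n}
                               else {p ! (j - 1), p ! j})) f g *\<^sub>R path_vec p))
      \<and> (j + 2 \<le> i \<longrightarrow>
          (\<forall>x \<in> \<R> V n.
            (regular_face f i \<circ> regular_coface V g j) x
              = - (regular_coface V g j \<circ> regular_face f (i - 1)) x)))
   \<and> (\<forall>i j. i + 1 \<le> j \<and> j \<le> n + 1 \<longrightarrow>
        (\<forall>x \<in> \<R> V n.
          (regular_coface V f i \<circ> regular_coface V g j) x
            = - (regular_coface V g (j + 1) \<circ> regular_coface V f i) x))"
  unfolding o_apply
proof (intro conjI allI impI ballI; (elim conjE)?)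
  fix i j p
  assume "j \<le> n + 1" and p: "p \<in> regular_paths V n"
  then show "regular_face f j (regular_coface V g j (path_vec p))
      = inner_on (V - (if j = 0 then {p ! 0}
                       else if j = n + 1 then {p ! n}
                       else {p ! (j - 1), p ! j})) f g *\<^sub>R path_vec p"
    by (intro face_coface_same_path_vec[OF assms])
      (simp_all add: regular_paths_def elementary_paths_def)
qed (erule (2) regular_face_regular_face regular_face_regular_coface_left
    regular_face_regular_coface_right regular_coface_regular_coface)+

end
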